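(* For any integers $n,s\ge 1$ and $m_1,\ldots,m_s\ge 0$, we have $$\sigma_n(m_1+\dotsb+m_s) \le \sigma_{n-1}(m_1)+\dotsb+\sigma_{n-1}(m_s) + \max\{m_1,\ldots,m_s\}.$$
   Context: $\mathbb{N}_0$ denotes the set of all non-negative integers, and $[a,b]$ denotes the set of integers from $a$ to $b$. For $n\ge 1$ and $i\in[1,n]$, $\pi_i$ is the orthogonal projection of $\mathbb{R}^n$ onto the coordinate hyperplane $\{(x_1,\ldots,x_n)\in\mathbb{R}^n : x_i=0\}$. (For $n=1$ the projection of any nonempty set has size $1$.) The cube order on $\mathbb{N}_0^n$ is the linear order in which $(x_1,\ldots,x_n)$ precedes $(y_1,\ldots,y_n)$ if there exist $l_0\in\mathbb{N}_0$ and $j\in[1,n]$ such that $\{i\in[1,n]: x_i=l\}=\{i\in[1,n]: y_i=l\}$ for each $l>l_0$, and also $\{i\in[j+1,n]: x_i=l_0\}=\{i\in[j+1,n]: y_i=l_0\}$, while $x_j<y_j=l_0$. For an integer $m\ge 0$, $\mathcal{I}_n(m)\subset\mathbb{N}_0^n$ denotes the length-$m$ initial segment of $\mathbb{N}_0^n$ with respect to the cube order, that is, the set of the $m$ smallest elements (with $\mathcal{I}_n(0)=\varnothing$). For integers $n\ge 1$ and $m\ge 0$, $\sigma_n(m):=\sum_{i=1}^n|\pi_i(\mathcal{I}_n(m))|$. By convention, $\sigma_0(m):=0$ for every $m\ge 0$ (empty sum). *)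

theory Defs
  imports Complex_Main
begin

text \<open>
  A point \<open>(x\<^sub>1, \<dots>, x\<^sub>n)\<close> is a function on \<^typ>\<open>nat\<close> that vanishes outside \<open>{1..n}\<close>, so that
  points with the same coordinates are equal and spaces of different dimension \<open>n\<close> live in one type.
\<close>

definition nat_points :: "nat \<Rightarrow> (nat \<Rightarrow> nat) set" where
  "nat_points n = {x. \<forall>i. i \<notin> {1..n} \<longrightarrow> x i = 0}"

text \<open>
  The orthogonal projection onto the coordinate hyperplane \<open>x\<^sub>i = 0\<close>; polymorphic, so that it can be
  applied to integer points without embedding them into the reals first.
\<close>

definition coord_proj :: "nat \<Rightarrow> (nat \<Rightarrow> 'a::zero) \<Rightarrow> nat \<Rightarrow> 'a" where
  "coord_proj i x = x(i := 0)"

definition cube_less :: "nat \<Rightarrow> (nat \<Rightarrow> nat) \<Rightarrow> (nat \<Rightarrow> nat) \<Rightarrow> bool" where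
  "cube_less n x y \<longleftrightarrow>
     (\<exists>l0. \<exists>j\<in>{1..n}.
        (\<forall>l>l0. {i\<in>{1..n}. x i = l} = {i\<in>{1..n}. y i = l}) \<and>
        {i\<in>{j+1..n}. x i = l0} = {i\<in>{j+1..n}. y i = l0} \<and>
        x j < y j \<and> y j = l0)"

definition is_cube_init_seg :: "nat \<Rightarrow> nat \<Rightarrow> (nat \<Rightarrow> nat) set \<Rightarrow> bool" where
  "is_cube_init_seg n m A \<longleftrightarrow>
     A \<subseteq> nat_points n \<and> finite A \<and> card A = m \<and>
     (\<forall>x\<in>A. \<forall>y\<in>nat_points n. cube_less n y x \<longrightarrow> y \<in> A)"

text \<open>
  For \<open>n \<ge> 1\<close> there is exactly one such set, see \<open>ex1_cube_init_seg\<close> below. For \<open>n = 0\<close> and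
  \<open>m \<ge> 2\<close> there is none, and the value is then irrelevant: \<open>shadow_sum 0 m\<close> is an empty sum.
\<close>

definition cube_init_seg :: "nat \<Rightarrow> nat \<Rightarrow> (nat \<Rightarrow> nat) set" where
  "cube_init_seg n m = (THE A. is_cube_init_seg n m A)"

definition shadow_sum :: "nat \<Rightarrow> nat \<Rightarrow> nat" where
  "shadow_sum n m = (\<Sum>i=1..n. card (coord_proj i ` cube_init_seg n m))"

text \<open>
  Well-posedness: the cube order is the numerical order of the codes below, the binary number whose
  digit at position \<open>l * n + i\<close> records whether \<open>x\<^sub>i = l\<close>.
\<close>

definition cube_code :: "nat \<Rightarrow> (nat \<Rightarrow> nat) \<Rightarrow> nat" where
  "cube_code n x = (\<Sum>i=1..n. 2 ^ (x i * n + i))"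

lemma cube_less_imp_code_less:
  assumes "cube_less n x y"
  shows "cube_code n x < cube_code n y"
proof -
  obtain l0 j where j: "j \<in> {1..n}" and xy: "x j < y j" "y j = l0"
    and gt: "\<And>l. l > l0 \<Longrightarrow> {i\<in>{1..n}. x i = l} = {i\<in>{1..n}. y i = l}"
    and eq: "{i\<in>{j+1..n}. x i = l0} = {i\<in>{j+1..n}. y i = l0}"
    using assms unfolding cube_less_def by blast
  define H where "H z = {i\<in>{1..n}. z i > l0 \<or> z i = l0 \<and> i > j}" for z :: "nat \<Rightarrow> nat"
  have gt': "x i = l \<longleftrightarrow> y i = l" if "i \<in> {1..n}" "l > l0" for i l
    using gt[OF that(2)] that(1) by blast
  have eq': "x i = l0 \<longleftrightarrow> y i = l0" if "i \<in> {1..n}" "i > j" for i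
  proof -
    have "i \<in> {j+1..n}" using that by simp
    then show ?thesis using eq by blast
  qed
  have Heq: "x i = y i" if "i \<in> H x" for i
    using that gt'[of i "x i"] eq'[of i] by (auto simp: H_def)
  have gt_iff: "x i > l0 \<longleftrightarrow> y i > l0" if "i \<in> {1..n}" for i
    using gt'[OF that, of "x i"] gt'[OF that, of "y i"] by auto
  have H': "H x = H y"
    unfolding H_def using gt_iff eq' by blast
  have split: "cube_code n z = (\<Sum>i\<in>H z. 2 ^ (z i * n + i)) + (\<Sum>i\<in>{1..n} - H z. 2 ^ (z i * n + i))"
    for z
    unfolding cube_code_def by (subst sum.subset_diff[of "H z"]) (auto simp: H_def)
  let ?e = "\<lambda>i. x i * n + i" and ?b = "l0 * n + j"
  have inj: "inj_on ?e ({1..n} - H x)"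
  proof (rule inj_onI)
    fix a b assume a: "a \<in> {1..n} - H x" and b: "b \<in> {1..n} - H x" and e: "?e a = ?e b"
    have "(x a * n + (a - 1)) mod n = (x b * n + (b - 1)) mod n"
      using a b e by (metis DiffD1 Nat.add_diff_assoc atLeastAtMost_iff)
    moreover have "a - 1 < n" "b - 1 < n" using a b by auto
    ultimately have "a - 1 = b - 1" by simp
    moreover have "a \<ge> 1" "b \<ge> 1" using a b by auto
    ultimately show "a = b" by linarith
  qed
  have sub: "?e ` ({1..n} - H x) \<subseteq> {..<?b}"
  proof (rule image_subsetI)
    fix i assume i: "i \<in> {1..n} - H x"
    show "?e i \<in> {..<?b}"
    proof (cases "x i < l0")
      case True
      then have "(x i + 1) * n \<le> l0 * n" by (intro mult_le_mono1) simp
      moreover have "i \<le> n" "j \<ge> 1" using i j by auto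
      ultimately show ?thesis by (simp add: algebra_simps)
    next
      case False
      then have "x i = l0" "i \<le> j" using i by (auto simp: H_def)
      moreover have "i \<noteq> j" using xy \<open>x i = l0\<close> by auto
      ultimately show ?thesis by simp
    qed
  qed
  have "(\<Sum>i\<in>{1..n} - H x. 2 ^ ?e i) = (\<Sum>k\<in>?e ` ({1..n} - H x). 2 ^ k :: nat)"
    by (subst sum.reindex[OF inj]) (simp add: o_def)
  also have "\<dots> \<le> (\<Sum>k<?b. 2 ^ k)"
    by (rule sum_mono2) (use sub in auto)
  also have "\<dots> < 2 ^ ?b"
    by (simp add: sum_power2 lessThan_atLeast0)
  also have "2 ^ ?b \<le> (\<Sum>i\<in>{1..n} - H x. 2 ^ (y i * n + i) :: nat)"
  proof -
    have "j \<in> {1..n} - H x" using j xy by (auto simp: H_def)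
    then show ?thesis
      using member_le_sum[of j "{1..n} - H x" "\<lambda>i. 2 ^ (y i * n + i) :: nat"] xy by simp
  qed
  finally have "(\<Sum>i\<in>{1..n} - H x. 2 ^ ?e i) < (\<Sum>i\<in>{1..n} - H x. 2 ^ (y i * n + i) :: nat)" .
  moreover have "(\<Sum>i\<in>H x. 2 ^ ?e i) = (\<Sum>i\<in>H x. 2 ^ (y i * n + i) :: nat)"
    by (rule sum.cong) (simp_all add: Heq)
  ultimately show ?thesis
    by (simp add: split H')
qed

lemma cube_less_total:
  assumes x: "x \<in> nat_points n" and y: "y \<in> nat_points n" and "x \<noteq> y"
  shows "cube_less n x y \<or> cube_less n y x"
proof -
  define D where "D = {i\<in>{1..n}. x i \<noteq> y i}"
  define l0 where "l0 = Max ((\<lambda>i. max (x i) (y i)) ` D)"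
  define J where "J = {i\<in>D. max (x i) (y i) = l0}"
  define j where "j = Max J"
  have fin: "finite D" "finite J" by (auto simp: D_def J_def)
  obtain k where "x k \<noteq> y k" using \<open>x \<noteq> y\<close> unfolding fun_eq_iff by blast
  moreover from this have "k \<in> {1..n}"
    using x y by (cases "k \<in> {1..n}") (simp_all add: nat_points_def)
  ultimately have "D \<noteq> {}" by (auto simp: D_def)
  then have "l0 \<in> (\<lambda>i. max (x i) (y i)) ` D"
    unfolding l0_def using fin by (intro Max_in) auto
  then have "J \<noteq> {}" by (auto simp: J_def)
  then have "j \<in> J" unfolding j_def using fin by (intro Max_in) auto
  then have j: "j \<in> {1..n}" "x j \<noteq> y j" "max (x j) (y j) = l0"
    by (auto simp: J_def D_def)
  have le: "max (x i) (y i) \<le> l0" if "i \<in> {1..n}" "x i \<noteq> y i" for i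
    unfolding l0_def using fin that by (intro Max_ge) (auto simp: D_def)
  have jle: "i \<le> j" if "i \<in> {1..n}" "x i \<noteq> y i" "max (x i) (y i) = l0" for i
    unfolding j_def using fin that by (intro Max_ge) (auto simp: D_def J_def)
  have "x i = l \<longleftrightarrow> y i = l" if "i \<in> {1..n}" "l > l0" for i l
    using le[OF that(1)] that(2) by (cases "x i = y i") auto
  then have gt: "{i\<in>{1..n}. x i = l} = {i\<in>{1..n}. y i = l}" if "l > l0" for l
    using that by blast
  have "x i = l0 \<longleftrightarrow> y i = l0" if "i \<in> {j+1..n}" for i
  proof (cases "x i = y i")
    case False
    have i: "i \<in> {1..n}" using that by simp
    then have "max (x i) (y i) \<noteq> l0" using jle[OF i False] that by auto
    then show ?thesis using le[OF i False] by auto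
  qed simp
  then have eq: "{i\<in>{j+1..n}. x i = l0} = {i\<in>{j+1..n}. y i = l0}" by blast
  show ?thesis
  proof (cases "x j < y j")
    case True
    then have "y j = l0" using j by auto
    with True have "cube_less n x y"
      unfolding cube_less_def using j(1) gt eq by (intro exI[of _ l0] bexI[of _ j]) simp_all
    then show ?thesis ..
  next
    case False
    then have "y j < x j" "x j = l0" using j by auto
    then have "cube_less n y x"
      unfolding cube_less_def using j(1) gt eq by (intro exI[of _ l0] bexI[of _ j]) simp_all
    then show ?thesis ..
  qed
qed

lemma inj_on_cube_code: "inj_on (cube_code n) (nat_points n)"
  by (rule inj_onI) (metis cube_less_total cube_less_imp_code_less less_irrefl)

lemma cube_less_iff_code_less:
  assumes "x \<in> nat_points n" and "y \<in> nat_points n"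
  shows "cube_less n x y \<longleftrightarrow> cube_code n x < cube_code n y"
  using cube_less_total[OF assms] cube_less_imp_code_less
  by (metis less_asym less_irrefl)

lemma infinite_nat_points:
  assumes "n \<ge> 1"
  shows "infinite (nat_points n)"
proof -
  have "inj (\<lambda>k i. if i = 1 then k else 0 :: nat)"
    by (rule injI) (metis (full_types))
  moreover have "range (\<lambda>k i. if i = 1 then k else 0 :: nat) \<subseteq> nat_points n"
    using assms by (auto simp: nat_points_def)
  ultimately show ?thesis
    by (metis finite_imageD finite_subset infinite_UNIV_nat)
qed

lemma is_cube_init_seg_unique:
  assumes A: "is_cube_init_seg n m A" and B: "is_cube_init_seg n m B"
  shows "A = B"
proof -
  have "A \<subseteq> B \<or> B \<subseteq> A"
  proof (rule ccontr)
    assume "\<not> (A \<subseteq> B \<or> B \<subseteq> A)"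
    then obtain a b where "a \<in> A" "a \<notin> B" "b \<in> B" "b \<notin> A" by blast
    moreover from this have "cube_less n a b \<or> cube_less n b a"
      using A B by (intro cube_less_total) (auto simp: is_cube_init_seg_def)
    ultimately show False
      using A B unfolding is_cube_init_seg_def by blast
  qed
  then show ?thesis
    using A B unfolding is_cube_init_seg_def by (metis card_subset_eq)
qed

lemma ex_cube_init_seg:
  assumes "n \<ge> 1"
  shows "\<exists>A. is_cube_init_seg n m A"
proof (induction m)
  case 0
  have "is_cube_init_seg n 0 {}" by (simp add: is_cube_init_seg_def)
  then show ?case ..
next
  case (Suc m)
  then obtain A where A: "is_cube_init_seg n m A" ..
  then have "nat_points n - A \<noteq> {}"
    using infinite_nat_points[OF assms] by (metis Diff_eq_empty_iff infinite_super is_cube_init_seg_def)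
  then obtain a where a: "a \<in> nat_points n - A"
    and least: "\<And>y. y \<in> nat_points n - A \<Longrightarrow> cube_code n a \<le> cube_code n y"
    using ex_has_least_nat[of "\<lambda>y. y \<in> nat_points n - A" _ "cube_code n"] by blast
  have "is_cube_init_seg n (Suc m) (insert a A)"
    unfolding is_cube_init_seg_def
  proof (intro conjI ballI impI)
    fix x y assume x: "x \<in> insert a A" and y: "y \<in> nat_points n" and less: "cube_less n y x"
    show "y \<in> insert a A"
    proof (cases "x = a")
      case True
      then show ?thesis
        using least[of y] cube_less_imp_code_less[OF less] y by force
    next
      case False
      then show ?thesis using A x y less by (auto simp: is_cube_init_seg_def)
    qed
  qed (use A a in \<open>auto simp: is_cube_init_seg_def\<close>)
  then show ?case ..
qed

lemma ex1_cube_init_seg: "n \<ge> 1 \<Longrightarrow> \<exists>!A. is_cube_init_seg n m A"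
  using ex_cube_init_seg is_cube_init_seg_unique by blast

lemma is_cube_init_seg_cube_init_seg: "n \<ge> 1 \<Longrightarrow> is_cube_init_seg n m (cube_init_seg n m)"
  unfolding cube_init_seg_def by (rule theI') (rule ex1_cube_init_seg)

lemma shadow_sum_0: "shadow_sum 0 m = 0"
  by (simp add: shadow_sum_def)

end

theory Submission
  imports Defs
begin

text \<open>
  For a down-set \<open>A\<close> the projection along the \<open>i\<close>-th axis is a copy of \<open>{x \<in> A. x\<^sub>i = 0}\<close>, so the sum
  of its projections is the weight \<open>\<Sum>x\<in>A. zeros x\<close>, where \<open>zeros x\<close> counts the vanishing coordinates
  of \<open>x\<close>. The inequality is a consequence of an isoperimetric fact: among the finite down-sets of a
  given size, initial segments of the cube order have the least weight
  (\<open>init_seg_minimises_weight\<close>).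

  To deduce the inequality, stack the nested \<open>(n-1)\<close>-dimensional initial segments of lengths
  \<open>m\<^sub>1, \<dots>, m\<^sub>s\<close> on top of each other, the largest at the bottom. The result is an \<open>n\<close>-dimensional
  down-set with \<open>m\<^sub>1 + \<dots> + m\<^sub>s\<close> points. Its projection onto the base has \<open>max m\<^sub>k\<close> points, and the layers
  contribute \<open>\<sigma>\<^sub>n\<^sub>-\<^sub>1(m\<^sub>k)\<close> each in the other directions. So the right-hand side is the weight of
  this down-set, and the left-hand side is the least possible weight.

  The isoperimetric fact is proved by induction on the number of coordinates. A down-set that is not
  an initial segment is replaced by one of the same size, no larger weight, and smaller sum of codes;
  this must stop. If some section \<open>x\<^sub>i = k\<close> is not an initial segment, all sections orthogonal to that axis
  are replaced by initial segments, and the induction hypothesis controls the weight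
  (\<open>compress_sections\<close>). Otherwise let \<open>x\<close> be the last point of the set and \<open>y\<close> the first point missing
  from it, so that \<open>y\<close> precedes \<open>x\<close>. As the sections are initial segments, \<open>x\<close> and \<open>y\<close> share no
  coordinate; moreover \<open>x\<close> exceeds \<open>y\<close> in a single coordinate \<open>j\<close>, the one that decides the order,
  and is smaller in all others. Hence \<open>y\<close> has at most one zero, and trading \<open>x\<close> for \<open>y\<close> is
  harmless unless \<open>x\<close> has none and \<open>y\<^sub>j = 0\<close>. In that case a whole segment below \<open>x\<close>, parallel to the
  axis of its smallest coordinate, is traded for an equally long segment parallel to the \<open>j\<close>-th axis
  that starts at \<open>y\<close>; each has exactly one zero in total (\<open>exchange_when_compressed\<close>).
\<close>

section \<open>Codes, initial segments and down-sets\<close>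

text \<open>
  Induction on the dimension passes to sections. Points of a section keep their coordinate labels
  and only lose the axis \<open>i\<close> from their support, so that a single numbering \<open>cube_code N\<close> serves for all
  dimensions and no axis has to be renumbered.
\<close>

definition supported :: "nat set \<Rightarrow> (nat \<Rightarrow> nat) set" where
  "supported S = {x. \<forall>i. i \<notin> S \<longrightarrow> x i = 0}"

definition init_seg :: "nat \<Rightarrow> nat set \<Rightarrow> (nat \<Rightarrow> nat) set \<Rightarrow> bool" where
  "init_seg N S A \<longleftrightarrow> A \<subseteq> supported S \<and> finite A \<and>
     (\<forall>x\<in>A. \<forall>y\<in>supported S. cube_code N y < cube_code N x \<longrightarrow> y \<in> A)"

definition down_set :: "(nat \<Rightarrow> nat) set \<Rightarrow> bool" where
  "down_set A \<longleftrightarrow> (\<forall>x\<in>A. \<forall>y\<le>x. y \<in> A)"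

definition code_sum :: "nat \<Rightarrow> (nat \<Rightarrow> nat) set \<Rightarrow> nat" where
  "code_sum N A = (\<Sum>x\<in>A. cube_code N x)"

definition zeros :: "nat set \<Rightarrow> (nat \<Rightarrow> nat) \<Rightarrow> nat" where
  "zeros S x = card {i\<in>S. x i = 0}"

definition weight :: "nat set \<Rightarrow> (nat \<Rightarrow> nat) set \<Rightarrow> nat" where
  "weight S A = (\<Sum>x\<in>A. zeros S x)"

lemma nat_points_eq_supported: "nat_points n = supported {1..n}"
  by (simp add: nat_points_def supported_def)

lemma supported_mono: "S \<subseteq> T \<Longrightarrow> supported S \<subseteq> supported T"
  by (auto simp: supported_def)

lemma supported_le: "x \<in> supported S \<Longrightarrow> y \<le> x \<Longrightarrow> y \<in> supported S"
  by (simp add: supported_def le_fun_def) (metis le_zero_eq)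

lemma supported_imp_nat_points: "S \<subseteq> {1..N} \<Longrightarrow> x \<in> supported S \<Longrightarrow> x \<in> nat_points N"
  using supported_mono nat_points_eq_supported by blast

text \<open>
  In the cube order everything is decided at the largest pair (value, index) at which the
  two points differ. This form does not mention the ambient dimension.
\<close>

lemma code_lessD:
  assumes "x \<in> nat_points N" "y \<in> nat_points N" "cube_code N x < cube_code N y"
  obtains j where "x j < y j"
    "\<And>i. x i \<noteq> y i \<Longrightarrow> max (x i) (y i) < y j \<or> max (x i) (y i) = y j \<and> i \<le> j"
proof -
  obtain l0 j where j: "j \<in> {1..N}" "x j < y j" "y j = l0"
    and gt: "\<And>l. l > l0 \<Longrightarrow> {i\<in>{1..N}. x i = l} = {i\<in>{1..N}. y i = l}"
    and eq: "{i\<in>{j+1..N}. x i = l0} = {i\<in>{j+1..N}. y i = l0}"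
    using assms cube_less_iff_code_less unfolding cube_less_def by blast
  have "max (x i) (y i) < y j \<or> max (x i) (y i) = y j \<and> i \<le> j" if ne: "x i \<noteq> y i" for i
  proof -
    have i: "i \<in> {1..N}"
      using ne assms by (cases "i \<in> {1..N}") (simp_all add: nat_points_def)
    have gt': "x i = l \<longleftrightarrow> y i = l" if "l > l0" for l
      using gt[OF that] i by blast
    have le: "max (x i) (y i) \<le> l0"
      using gt'[of "x i"] gt'[of "y i"] ne by (metis max_def not_le)
    have "i \<le> j" if "max (x i) (y i) = l0"
    proof (rule ccontr)
      assume "\<not> i \<le> j"
      then have "i \<in> {j+1..N}" using i by simp
      then have "x i = l0 \<longleftrightarrow> y i = l0" using eq by blast
      then show False using that ne by auto
    qed
    then show ?thesis using le j(3) le_neq_implies_less by blast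
  qed
  with j show thesis using that by blast
qed

text \<open>
  The coordinate \<open>i\<close> need not be the deciding one: it suffices that it beats every coordinate in which
  \<open>x\<close> is the larger. Were \<open>y\<close> before \<open>x\<close>, the deciding coordinate would be one of the latter.
\<close>

lemma code_lessI:
  assumes "x \<in> nat_points N" "y \<in> nat_points N" and i: "x i < y i"
    and dom: "\<And>t. y t < x t \<Longrightarrow> x t < y i \<or> x t = y i \<and> t < i"
  shows "cube_code N x < cube_code N y"
proof (rule ccontr)
  assume "\<not> ?thesis"
  moreover have "x \<noteq> y" using i by auto
  then have "cube_code N x \<noteq> cube_code N y"
    using inj_onD[OF inj_on_cube_code[of N] _ assms(1,2)] by blast
  ultimately have "cube_code N y < cube_code N x" by simp
  from code_lessD[OF assms(2,1) this] obtain j where j: "y j < x j"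
    "\<And>i. y i \<noteq> x i \<Longrightarrow> max (y i) (x i) < x j \<or> max (y i) (x i) = x j \<and> i \<le> j" by blast
  have "y i \<noteq> x i" using i by simp
  from j(2)[OF this] dom[OF j(1)] i show False by linarith
qed

lemma code_eq_iff:
  "S \<subseteq> {1..N} \<Longrightarrow> x \<in> supported S \<Longrightarrow> y \<in> supported S \<Longrightarrow>
    cube_code N x = cube_code N y \<longleftrightarrow> x = y"
  using inj_on_eq_iff[OF inj_on_cube_code] supported_imp_nat_points by blast

lemma cube_code_mono: "x \<le> y \<Longrightarrow> cube_code N x \<le> cube_code N y"
  unfolding cube_code_def by (intro sum_mono power_increasing) (simp_all add: le_fun_def)

lemma init_seg_down_set:
  assumes "S \<subseteq> {1..N}" "init_seg N S A"
  shows "down_set A"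
  unfolding down_set_def
proof (intro ballI allI impI)
  fix x y assume x: "x \<in> A" and le: "y \<le> x"
  then have s: "x \<in> supported S" "y \<in> supported S"
    using assms supported_le unfolding init_seg_def by blast+
  show "y \<in> A"
  proof (cases "x = y")
    case False
    then have "cube_code N y < cube_code N x"
      using cube_code_mono[OF le] code_eq_iff[OF assms(1) s] by (metis le_neq_implies_less)
    then show ?thesis using assms x s unfolding init_seg_def by blast
  qed (use x in simp)
qed

lemma init_seg_subset:
  assumes "S \<subseteq> {1..N}" "init_seg N S A" "init_seg N S B" "card A \<le> card B"
  shows "A \<subseteq> B"
proof (rule ccontr)
  assume "\<not> A \<subseteq> B"
  then obtain a where a: "a \<in> A" "a \<notin> B" by blast
  have "B \<subseteq> A"
  proof
    fix b assume b: "b \<in> B"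
    have s: "a \<in> supported S" "b \<in> supported S" using a b assms unfolding init_seg_def by blast+
    have "cube_code N a \<noteq> cube_code N b" using code_eq_iff[OF assms(1) s] a b by blast
    then have "cube_code N b < cube_code N a"
      using assms(3) a b s unfolding init_seg_def by (meson nat_neq_iff)
    then show "b \<in> A" using assms(2) a s unfolding init_seg_def by blast
  qed
  then show False
    using a assms(2,4) unfolding init_seg_def by (metis card_seteq)
qed

text \<open>
  Trading a point of \<open>B\<close> for an earlier missing one lowers the sum of codes, and this can only
  go on until an initial segment is reached. The strict case makes compression terminate.
\<close>

lemma ex_init_seg_code_sum_less:
  assumes "finite B" "B \<subseteq> supported S"
  shows "\<exists>I. init_seg N S I \<and> card I = card B \<and> code_sum N I \<le> code_sum N B \<and>
    (\<not> init_seg N S B \<longrightarrow> code_sum N I < code_sum N B)"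
  using assms
proof (induction "code_sum N B" arbitrary: B rule: less_induct)
  case less
  show ?case
  proof (cases "init_seg N S B")
    case False
    then obtain x y where xy: "x \<in> B" "y \<in> supported S" "cube_code N y < cube_code N x" "y \<notin> B"
      using less.prems unfolding init_seg_def by blast
    let ?B = "insert y (B - {x})"
    have 1: "code_sum N ?B < code_sum N B"
      using xy less.prems sum.remove[of B x "cube_code N"] by (simp add: code_sum_def)
    have 2: "card ?B = card B"
      using xy less.prems card_Suc_Diff1[of B x] by simp
    have "finite ?B" "?B \<subseteq> supported S" using xy less.prems by auto
    from less.hyps[OF 1 this] show ?thesis using 1 2 by fastforce
  qed auto
qed

section \<open>Stacking sections\<close>

definition stack :: "nat \<Rightarrow> (nat \<Rightarrow> (nat \<Rightarrow> nat) set) \<Rightarrow> (nat \<Rightarrow> nat) set" where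
  "stack i B = {x. x(i := 0) \<in> B (x i)}"

text \<open>
  The bound \<open>K\<close> on the number of nonempty layers turns sums over a stack into double sums over finite
  ranges.
\<close>

definition stackable :: "nat \<Rightarrow> nat \<Rightarrow> (nat \<Rightarrow> (nat \<Rightarrow> nat) set) \<Rightarrow> bool" where
  "stackable i K B \<longleftrightarrow>
     (\<forall>k. finite (B k) \<and> (\<forall>p\<in>B k. p i = 0)) \<and> (\<forall>k\<ge>K. B k = {})"

lemma stack_eq_UN:
  assumes "stackable i K B"
  shows "stack i B = (\<Union>k<K. (\<lambda>p. p(i := k)) ` B k)"
proof (intro set_eqI iffI)
  fix x assume "x \<in> stack i B"
  then have "x(i := 0) \<in> B (x i)" by (simp add: stack_def)
  moreover from this have "x i < K" using assms unfolding stackable_def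
    by (metis empty_iff not_less)
  moreover have "x = (x(i := 0))(i := x i)" by simp
  ultimately show "x \<in> (\<Union>k<K. (\<lambda>p. p(i := k)) ` B k)" by blast
next
  fix x assume "x \<in> (\<Union>k<K. (\<lambda>p. p(i := k)) ` B k)"
  then obtain k p where "p \<in> B k" "x = p(i := k)" by blast
  then show "x \<in> stack i B" using assms by (auto simp: stackable_def stack_def fun_upd_idem)
qed

lemma sum_stack:
  assumes "stackable i K B"
  shows "(\<Sum>x\<in>stack i B. f x) = (\<Sum>k<K. \<Sum>p\<in>B k. f (p(i := k)))"
proof -
  have inj: "inj_on (\<lambda>p. p(i := k)) (B k)" for k
  proof (rule inj_onI)
    fix p q assume "p \<in> B k" "q \<in> B k" "p(i := k) = q(i := k)"
    then show "p = q" using assms unfolding stackable_def by (metis fun_upd_triv fun_upd_upd)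
  qed
  have "(\<Sum>x\<in>stack i B. f x) = (\<Sum>k<K. \<Sum>x\<in>(\<lambda>p. p(i := k)) ` B k. f x)"
    unfolding stack_eq_UN[OF assms]
  proof (rule sum.UNION_disjoint)
    show "\<forall>k\<in>{..<K}. \<forall>l\<in>{..<K}. k \<noteq> l \<longrightarrow>
        (\<lambda>p. p(i := k)) ` B k \<inter> (\<lambda>p. p(i := l)) ` B l = {}"
      by (auto dest: fun_cong[where x = i])
  qed (use assms in \<open>auto simp: stackable_def\<close>)
  also have "\<dots> = (\<Sum>k<K. \<Sum>p\<in>B k. f (p(i := k)))"
    by (rule sum.cong) (simp_all add: sum.reindex[OF inj])
  finally show ?thesis .
qed

lemma finite_stack:
  assumes "stackable i K B"
  shows "finite (stack i B)"
  unfolding stack_eq_UN[OF assms] using assms by (simp add: stackable_def)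

lemma card_stack:
  assumes "stackable i K B"
  shows "card (stack i B) = (\<Sum>k<K. card (B k))"
  using sum_stack[OF assms, of "\<lambda>_. 1 :: nat"] by simp

lemma down_set_stack:
  assumes "\<And>k. down_set (B k)" "\<And>k l. k \<le> l \<Longrightarrow> B l \<subseteq> B k"
  shows "down_set (stack i B)"
  unfolding down_set_def
proof (intro ballI allI impI)
  fix x y assume "x \<in> stack i B" and le: "y \<le> x"
  then have "x(i := 0) \<in> B (x i)" by (simp add: stack_def)
  moreover have "y(i := 0) \<le> x(i := 0)" "y i \<le> x i" using le by (auto simp: le_fun_def)
  ultimately show "y \<in> stack i B"
    using assms unfolding stack_def down_set_def by blast
qed

lemma stack_supported:
  assumes "\<And>k. B k \<subseteq> supported (S - {i})" "i \<in> S"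
  shows "stack i B \<subseteq> supported S"
proof
  fix x assume "x \<in> stack i B"
  then have "x(i := 0) \<in> supported (S - {i})" using assms by (auto simp: stack_def)
  then show "x \<in> supported S" using assms(2) unfolding supported_def
    by (auto split: if_splits)
qed

lemma zeros_upd:
  assumes "finite S" "i \<in> S"
  shows "zeros S (p(i := k)) = zeros (S - {i}) p + (if k = 0 then 1 else 0)"
proof -
  have "{t\<in>S. (p(i := k)) t = 0} = {t\<in>S - {i}. p t = 0} \<union> (if k = 0 then {i} else {})"
    using assms(2) by auto
  then show ?thesis using assms(1) unfolding zeros_def by simp
qed

text \<open>
  The layers keep the weights they have one dimension lower; only the points of the bottom layer have an
  additional zero, at \<open>i\<close>.
\<close>

lemma weight_stack:
  assumes "finite S" "i \<in> S"
    and "stackable i K B"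
  shows "weight S (stack i B) = (\<Sum>k<K. weight (S - {i}) (B k)) + card (B 0)"
proof -
  have "weight S (stack i B) =
      (\<Sum>k<K. \<Sum>p\<in>B k. zeros (S - {i}) p + (if k = 0 then 1 else 0))"
    unfolding weight_def sum_stack[OF assms(3)] by (simp add: zeros_upd[OF assms(1,2)])
  also have "\<dots> = (\<Sum>k<K. weight (S - {i}) (B k) + (if k = 0 then card (B 0) else 0))"
    by (intro sum.cong) (auto simp: weight_def sum.distrib)
  also have "\<dots> = (\<Sum>k<K. weight (S - {i}) (B k)) + card (B 0)"
    using assms(3) by (auto simp: stackable_def sum.distrib)
  finally show ?thesis .
qed

text \<open>
  Moving a section to height \<open>k\<close> shifts all its codes by the same amount, hence preserves their order.
\<close>

lemma cube_code_upd:
  assumes "i \<in> {1..N}" "p i = 0"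
  shows "cube_code N (p(i := k)) = cube_code N p + (2 ^ (k * N + i) - 2 ^ i)"
proof -
  have "cube_code N (p(i := k)) = 2 ^ (k * N + i) + (\<Sum>t\<in>{1..N} - {i}. 2 ^ (p t * N + t))"
    unfolding cube_code_def using assms(1) by (subst sum.remove[of _ i]) simp_all
  moreover have "cube_code N p = 2 ^ i + (\<Sum>t\<in>{1..N} - {i}. 2 ^ (p t * N + t))"
    unfolding cube_code_def using assms by (subst sum.remove[of _ i]) simp_all
  moreover have "(2::nat) ^ i \<le> 2 ^ (k * N + i)" by (rule power_increasing) simp_all
  ultimately show ?thesis by simp
qed

lemma code_sum_stack:
  assumes "i \<in> {1..N}"
    and "stackable i K B"
  shows "code_sum N (stack i B) =
    (\<Sum>k<K. code_sum N (B k) + card (B k) * (2 ^ (k * N + i) - 2 ^ i))"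
proof -
  have "cube_code N (p(i := k)) = cube_code N p + (2 ^ (k * N + i) - 2 ^ i)" if "p \<in> B k" for k p
    using that assms by (intro cube_code_upd) (auto simp: stackable_def)
  then have "(\<Sum>p\<in>B k. cube_code N (p(i := k))) =
      (\<Sum>p\<in>B k. cube_code N p + (2 ^ (k * N + i) - 2 ^ i))" for k
    by (intro sum.cong) auto
  then show ?thesis
    unfolding code_sum_def sum_stack[OF assms(2)] by (simp only: sum.distrib sum_constant) simp
qed

section \<open>Compressing sections\<close>

definition section_at :: "nat \<Rightarrow> (nat \<Rightarrow> nat) set \<Rightarrow> nat \<Rightarrow> (nat \<Rightarrow> nat) set" where
  "section_at i A k = {p. p i = 0 \<and> p(i := k) \<in> A}"

lemma stack_section_at: "stack i (section_at i A) = A"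
  by (auto simp: stack_def section_at_def)

text \<open>
  The sections of a down-set decrease with the height, so their sizes do, and the initial
  segments of these sizes are nested again: their stack is a down-set. The bottom section keeps its size,
  so by \<open>weight_stack\<close> only the weights within the layers matter.
\<close>

lemma compress_sections:
  assumes S: "S \<subseteq> {1..N}" and i: "i \<in> S"
    and A: "finite A" "A \<subseteq> supported S" "down_set A"
    and bad: "\<not> init_seg N (S - {i}) (section_at i A k0)"
    and IH: "\<And>B I. finite B \<Longrightarrow> B \<subseteq> supported (S - {i}) \<Longrightarrow> down_set B \<Longrightarrow>
      init_seg N (S - {i}) I \<Longrightarrow> card I = card B \<Longrightarrow> weight (S - {i}) I \<le> weight (S - {i}) B"
  shows "\<exists>A'. finite A' \<and> A' \<subseteq> supported S \<and> down_set A' \<and> card A' = card A \<and>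
    weight S A' \<le> weight S A \<and> code_sum N A' < code_sum N A"
proof -
  define B where "B = section_at i A"
  have finS: "finite S" using S finite_subset by blast
  have S': "S - {i} \<subseteq> {1..N}" and iN: "i \<in> {1..N}" using S i by auto
  have B0: "p i = 0" if "p \<in> B k" for p k using that by (simp add: B_def section_at_def)
  have Bs: "B k \<subseteq> supported (S - {i})" for k
  proof
    fix p assume "p \<in> B k"
    then have "p i = 0" "p(i := k) \<in> supported S"
      using A(2) by (auto simp: B_def section_at_def)
    then show "p \<in> supported (S - {i})" unfolding supported_def
      by (auto split: if_splits)
  qed
  have Bimg: "B k \<subseteq> (\<lambda>x. x(i := 0)) ` A" for k
  proof
    fix p assume "p \<in> B k"
    then have "p = (p(i := k))(i := 0)" "p(i := k) \<in> A"
      by (auto simp: B_def section_at_def fun_upd_idem)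
    then show "p \<in> (\<lambda>x. x(i := 0)) ` A" by blast
  qed
  have Bfin: "finite (B k)" for k using Bimg A(1) by (meson finite_imageI finite_subset)
  obtain K where K: "\<And>x. x \<in> A \<Longrightarrow> x i < K"
    using A(1) finite_nat_set_iff_bounded[of "(\<lambda>x. x i) ` A"] by auto
  have BK: "B k = {}" if "k \<ge> K" for k
    using K that by (fastforce simp: B_def section_at_def)
  have Bdown: "down_set (B k)" for k
    unfolding down_set_def
  proof (intro ballI allI impI)
    fix x y assume x: "x \<in> B k" and le: "y \<le> x"
    have "y i \<le> x i" using le by (simp add: le_fun_def)
    moreover have "y(i := k) \<le> x(i := k)" using le by (auto simp: le_fun_def)
    ultimately show "y \<in> B k" using x A(3) by (auto simp: B_def section_at_def down_set_def)
  qed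
  have Banti: "B l \<subseteq> B k" if "k \<le> l" for k l
  proof
    fix p assume p: "p \<in> B l"
    have "p(i := k) \<le> p(i := l)" using that by (auto simp: le_fun_def)
    then show "p \<in> B k" using p A(3) by (auto simp: B_def section_at_def down_set_def)
  qed
  have "\<forall>k. \<exists>I. init_seg N (S - {i}) I \<and> card I = card (B k) \<and> code_sum N I \<le> code_sum N (B k) \<and>
    (\<not> init_seg N (S - {i}) (B k) \<longrightarrow> code_sum N I < code_sum N (B k))"
    using ex_init_seg_code_sum_less[OF Bfin Bs] by blast
  then obtain I where I: "\<And>k. init_seg N (S - {i}) (I k)" "\<And>k. card (I k) = card (B k)"
    "\<And>k. code_sum N (I k) \<le> code_sum N (B k)"
    "\<And>k. \<not> init_seg N (S - {i}) (B k) \<Longrightarrow> code_sum N (I k) < code_sum N (B k)"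
    by metis
  have Is: "I k \<subseteq> supported (S - {i})" and Ifin: "finite (I k)" for k
    using I(1) unfolding init_seg_def by auto
  have I0: "p i = 0" if "p \<in> I k" for p k
    using Is that by (auto simp: supported_def)
  have IK: "I k = {}" if "k \<ge> K" for k
    using I(2)[of k] BK[OF that] Ifin[of k] by simp
  have stB: "stackable i K B" and stI: "stackable i K I"
    using Bfin B0 BK Ifin I0 IK by (auto simp: stackable_def)
  have Ianti: "I l \<subseteq> I k" if "k \<le> l" for k l
    by (rule init_seg_subset[OF S' I(1) I(1)]) (simp add: I(2) card_mono[OF Bfin Banti[OF that]])
  have AB: "A = stack i B" by (simp add: B_def stack_section_at)
  have "k0 < K"
  proof (rule ccontr)
    assume "\<not> k0 < K"
    then have "section_at i A k0 = {}" using BK[of k0] by (simp add: B_def)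
    then show False using bad by (simp add: init_seg_def)
  qed
  then have "code_sum N (stack i I) < code_sum N A"
    unfolding AB code_sum_stack[OF iN stI] code_sum_stack[OF iN stB]
    using I(3,4) bad by (intro sum_strict_mono_ex1) (auto simp: I(2) B_def)
  moreover have "weight S (stack i I) \<le> weight S A"
    unfolding AB weight_stack[OF finS i stI] weight_stack[OF finS i stB] I(2)
    by (intro add_right_mono sum_mono IH Bfin Bs Bdown I)
  moreover have "card (stack i I) = card A"
    unfolding AB card_stack[OF stI] card_stack[OF stB] by (simp add: I(2))
  moreover have "down_set (stack i I)"
    using init_seg_down_set[OF S' I(1)] Ianti by (rule down_set_stack)
  ultimately show ?thesis
    using finite_stack[OF stI] stack_supported[OF Is i] by (intro exI[of _ "stack i I"]) simp
qed

section \<open>Exchanging the last point against the first gap\<close>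

lemma exchange_sets:
  assumes A: "finite A" "A \<subseteq> supported S" "down_set A"
    and R: "R \<subseteq> A" "\<And>r a. r \<in> R \<Longrightarrow> a \<in> A \<Longrightarrow> r \<le> a \<Longrightarrow> a \<in> R"
    and T: "finite T" "T \<subseteq> supported S" "T \<inter> A = {}"
      "\<And>t u. t \<in> T \<Longrightarrow> u \<le> t \<Longrightarrow> u \<in> T \<or> u \<in> A - R"
    and RT: "card R = card T" "weight S T \<le> weight S R" "code_sum N T < code_sum N R"
  shows "\<exists>A'. finite A' \<and> A' \<subseteq> supported S \<and> down_set A' \<and> card A' = card A \<and>
    weight S A' \<le> weight S A \<and> code_sum N A' < code_sum N A"
proof -
  let ?A = "(A - R) \<union> T"
  have fR: "finite R" using A(1) R(1) finite_subset by blast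
  have sum: "(\<Sum>x\<in>?A. f x) = (\<Sum>x\<in>A - R. f x) + (\<Sum>x\<in>T. f x)"
    and sum': "(\<Sum>x\<in>A. f x) = (\<Sum>x\<in>A - R. f x) + (\<Sum>x\<in>R. f x)" for f :: "_ \<Rightarrow> nat"
    using A(1) T(1,3) R(1) by (auto intro!: sum.union_disjoint sum.subset_diff)
  have "card ?A = card A" using sum[of "\<lambda>_. 1"] sum'[of "\<lambda>_. 1"] RT(1) by simp
  moreover have "weight S ?A \<le> weight S A"
    using RT(2) unfolding weight_def sum sum'[of "zeros S"] by simp
  moreover have "code_sum N ?A < code_sum N A"
    using RT(3) unfolding code_sum_def sum sum'[of "cube_code N"] by simp
  moreover have "down_set ?A"
    unfolding down_set_def
  proof (intro ballI allI impI)
    fix x y assume x: "x \<in> ?A" and le: "y \<le> x"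
    show "y \<in> ?A"
    proof (cases "x \<in> T")
      case True
      then show ?thesis using T(4) le by blast
    next
      case False
      then have "x \<in> A" "x \<notin> R" using x by auto
      then show ?thesis using A(3) R(2) le unfolding down_set_def by blast
    qed
  qed
  ultimately show ?thesis using A(1,2) T(1,2) by (intro exI[of _ ?A]) auto
qed

text \<open>
  The hypothesis \<open>compr\<close> says that every section of \<open>A\<close> is an initial segment. The exchange cannot always
  be made with single points: for \<open>x = (1, 1, 2)\<close> and \<open>y = (2, 2, 0)\<close> it would raise the weight, and
  the segment \<open>(0, 1, 2), (1, 1, 2)\<close> has to be exchanged for \<open>(2, 2, 0), (2, 2, 1)\<close>.
\<close>

lemma exchange_when_compressed:
  assumes S: "S \<subseteq> {1..N}"
    and A: "finite A" "A \<subseteq> supported S" "down_set A"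
    and notinit: "\<not> init_seg N S A"
    and compr: "\<And>u v i. u \<in> A \<Longrightarrow> v \<in> supported S \<Longrightarrow> i \<in> S \<Longrightarrow> u i = v i \<Longrightarrow>
      cube_code N v < cube_code N u \<Longrightarrow> v \<in> A"
  shows "\<exists>A'. finite A' \<and> A' \<subseteq> supported S \<and> down_set A' \<and> card A' = card A \<and>
    weight S A' \<le> weight S A \<and> code_sum N A' < code_sum N A"
proof -
  have finS: "finite S" using S finite_subset by blast
  note np = supported_imp_nat_points[OF S]
  obtain x0 y0 where xy0: "x0 \<in> A" "y0 \<in> supported S" "y0 \<notin> A" "cube_code N y0 < cube_code N x0"
    using notinit A unfolding init_seg_def by blast
  obtain x where x: "x \<in> A" and xmax: "\<And>a. a \<in> A \<Longrightarrow> cube_code N a \<le> cube_code N x"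
  proof -
    have "Max (cube_code N ` A) \<in> cube_code N ` A" using A(1) xy0(1) by (intro Max_in) auto
    then obtain x where "x \<in> A" "cube_code N x = Max (cube_code N ` A)" by auto
    then show thesis using that[of x] A(1) by simp
  qed
  obtain y where y: "y \<in> supported S" "y \<notin> A"
    and ymin: "\<And>v. v \<in> supported S \<Longrightarrow> cube_code N v < cube_code N y \<Longrightarrow> v \<in> A"
    using ex_has_least_nat[of "\<lambda>v. v \<in> supported S \<and> v \<notin> A" y0 "cube_code N"] xy0
    by (metis not_less)
  have yx: "cube_code N y < cube_code N x"
    using xmax[OF xy0(1)] xy0 ymin[of y0] by fastforce
  have xs: "x \<in> supported S" using x A by blast
  have sup_upd: "v(i := c) \<in> supported S" if "v \<in> supported S" "i \<in> S" for v i c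
    using that by (auto simp: supported_def)
  obtain j where j: "y j < x j"
    and jtop: "\<And>i. y i \<noteq> x i \<Longrightarrow> max (y i) (x i) < x j \<or> max (y i) (x i) = x j \<and> i \<le> j"
    using code_lessD[OF np[OF y(1)] np[OF xs] yx] by blast
  have jS: "j \<in> S" using j xs by (cases "j \<in> S") (auto simp: supported_def)
  have below: "y t < x j \<or> y t = x j \<and> t < j" if "x t < y t" for t
    using jtop[of t] that j by (cases "t = j") auto
  \<comment> \<open>Otherwise \<open>x\<close> with \<open>i\<close>-th coordinate taken from \<open>y\<close> is below \<open>x\<close>, hence in \<open>A\<close>; it comes after \<open>y\<close>
    because of the coordinate \<open>j\<close>, and shares a coordinate with \<open>y\<close>, which puts \<open>y\<close> into \<open>A\<close>.\<close>
  have x_lt_y: "x i < y i" if i: "i \<in> S" "i \<noteq> j" for i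
  proof (rule ccontr)
    assume "\<not> x i < y i"
    then have "x(i := y i) \<le> x" by (auto simp: le_fun_def)
    then have "x(i := y i) \<in> A" using x A(3) unfolding down_set_def by blast
    moreover have "cube_code N y < cube_code N (x(i := y i))"
      using i j below by (intro code_lessI[of _ _ _ j] np y sup_upd xs) (auto split: if_splits)
    ultimately show False using compr[of "x(i := y i)" y i] y i by simp
  qed
  have lt_xj: "x i < x j" if "i \<in> S" "i \<noteq> j" for i
    using below[OF x_lt_y[OF that]] x_lt_y[OF that] by auto
  show ?thesis
  proof (cases "zeros S y \<le> zeros S x")
    case True
    show ?thesis
    proof (rule exchange_sets[OF A, of "{x}" "{y}"])
      show "a \<in> {x}" if "r \<in> {x}" "a \<in> A" "r \<le> a" for r a
        using that xmax[OF that(2)] cube_code_mono[of x a N] code_eq_iff[OF S, of x a] A(2) xs by auto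
      show "u \<in> {y} \<or> u \<in> A - {x}" if "t \<in> {y}" "u \<le> t" for t u
      proof (cases "u = y")
        case False
        have us: "u \<in> supported S" using that y supported_le by blast
        then have "cube_code N u < cube_code N y"
          using that False code_eq_iff[OF S us y(1)] cube_code_mono[of u y N] by auto
        then show ?thesis using ymin[OF us] yx by auto
      qed simp
    qed (use x y yx True in \<open>auto simp: weight_def code_sum_def\<close>)
  next
    case False
    have sub: "{i\<in>S. y i = 0} \<subseteq> {j}" using x_lt_y by force
    then have "zeros S y \<le> 1" unfolding zeros_def
      using card_mono[of "{j}"] by fastforce
    with False have "zeros S x = 0" "zeros S y = 1" by auto
    then have xpos: "x i \<noteq> 0" if "i \<in> S" for i
      using that finS unfolding zeros_def by auto
    have "{i\<in>S. y i = 0} \<noteq> {}"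
      using \<open>zeros S y = 1\<close> unfolding zeros_def by (metis card.empty zero_neq_one)
    with sub have yj: "y j = 0" by blast
    have "S \<noteq> {j}"
    proof
      assume "S = {j}"
      then have "y \<le> x" using y(1) j by (auto simp: supported_def le_fun_def) (metis less_imp_le zero_le)
      then show False using x y A(3) unfolding down_set_def by blast
    qed
    then obtain i where i: "i \<in> S" "i \<noteq> j" using jS by blast
    \<comment> \<open>Minimality of \<open>x k\<close> makes the segment below \<open>x\<close> removable: a point of \<open>A\<close> above the segment but not
      on it would exceed \<open>x\<close> in a coordinate that outweighs any loss in the coordinate \<open>k\<close>. It also
      keeps the new segment so short that decreasing any coordinate of its points other than
      \<open>j\<close> leads to a point before \<open>y\<close>, which lies in \<open>A\<close>.\<close>
    obtain k where k: "k \<in> S" and kmin: "\<And>t. t \<in> S \<Longrightarrow> x k \<le> x t"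
      using ex_has_least_nat[of "\<lambda>t. t \<in> S" i x] i by blast
    have kj: "k \<noteq> j" using kmin[OF i(1)] lt_xj[OF i] by auto
    let ?R = "(\<lambda>c. x(k := c)) ` {..x k}" and ?T = "(\<lambda>c. y(j := c)) ` {..x k}"
    have injR: "inj_on (\<lambda>c. x(k := c)) {..x k}" and injT: "inj_on (\<lambda>c. y(j := c)) {..x k}"
      by (metis (no_types, lifting) inj_onI fun_upd_same)+
    have y_lt_R: "cube_code N (y(j := c)) < cube_code N (x(k := d))" if "c \<le> x k" for c d
      using below below[OF x_lt_y[OF k kj]] lt_xj[OF k kj] kj that
      by (intro code_lessI[of _ _ _ j] np sup_upd y xs jS k) (auto split: if_splits)
    show ?thesis
    proof (rule exchange_sets[OF A, of ?R ?T])
      show "?R \<subseteq> A"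
      proof
        fix r assume "r \<in> ?R"
        then have "r \<le> x" by (auto simp: le_fun_def)
        then show "r \<in> A" using x A(3) unfolding down_set_def by blast
      qed
      show "a \<in> ?R" if "r \<in> ?R" "a \<in> A" "r \<le> a" for r a
      proof -
        have as: "a \<in> supported S" using that A by blast
        obtain d where "r = x(k := d)" using \<open>r \<in> ?R\<close> by blast
        then have ge: "x t \<le> a t" if "t \<noteq> k" for t
          using le_funD[OF \<open>r \<le> a\<close>, of t] that by simp
        have eq: "a t = x t" if "t \<noteq> k" for t
        proof (rule ccontr)
          assume "a t \<noteq> x t"
          then have lt: "x t < a t" using ge[OF that] by simp
          then have "t \<in> S" using as by (cases "t \<in> S") (auto simp: supported_def)
          have "cube_code N x < cube_code N a"
          proof (rule code_lessI[OF np[OF xs] np[OF as] lt])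
            fix s assume "a s < x s"
            then have "s = k" using ge[of s] by (cases "s = k") auto
            then show "x s < a t \<or> x s = a t \<and> s < t" using kmin[OF \<open>t \<in> S\<close>] lt by simp
          qed
          then show False using xmax[OF \<open>a \<in> A\<close>] by simp
        qed
        have "a k \<le> x k"
        proof (rule ccontr)
          assume "\<not> a k \<le> x k"
          then have lt: "x k < a k" by simp
          have "x t \<le> a t" for t using eq[of t] lt by (cases "t = k") auto
          then have "cube_code N x < cube_code N a"
            by (intro code_lessI[OF np[OF xs] np[OF as] lt]) (meson not_less)
          then show False using xmax[OF \<open>a \<in> A\<close>] by simp
        qed
        moreover have "a = x(k := a k)" using eq by auto
        ultimately show ?thesis by blast
      qed
      show "?T \<subseteq> supported S" using sup_upd[OF y(1) jS] by blast
      show "?T \<inter> A = {}"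
      proof -
        have "y \<le> y(j := c)" for c using yj by (auto simp: le_fun_def)
        then show ?thesis using y A(3) unfolding down_set_def by blast
      qed
      show "u \<in> ?T \<or> u \<in> A - ?R" if "t \<in> ?T" "u \<le> t" for t u
      proof -
        obtain c where c: "c \<le> x k" "t = y(j := c)" using \<open>t \<in> ?T\<close> by blast
        have us: "u \<in> supported S" using supported_le[OF sup_upd[OF y(1) jS], of u c] \<open>u \<le> t\<close> c by simp
        have uj: "u j \<le> x k"
          using le_funD[OF \<open>u \<le> t\<close>, of j] c by simp
        have ut: "u s \<le> y s" if "s \<noteq> j" for s
          using le_funD[OF \<open>u \<le> t\<close>, of s] c that by simp
        show ?thesis
        proof (cases "\<forall>s. s \<noteq> j \<longrightarrow> u s = y s")
          case True
          then have "u = y(j := u j)" by auto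
          then show ?thesis using uj by blast
        next
          case False
          then obtain s where s: "s \<noteq> j" "u s < y s" using ut by (metis le_neq_implies_less)
          then have "s \<in> S" using y(1) by (cases "s \<in> S") (auto simp: supported_def)
          have "x k < y s" using kmin[OF \<open>s \<in> S\<close>] x_lt_y[OF \<open>s \<in> S\<close> s(1)] by simp
          have "cube_code N u < cube_code N y"
          proof (rule code_lessI[OF np[OF us] np[OF y(1)] s(2)])
            fix q assume "y q < u q"
            then have "q = j" using ut[of q] by (cases "q = j") auto
            then show "u q < y s \<or> u q = y s \<and> q < s" using uj \<open>x k < y s\<close> by simp
          qed
          moreover have "cube_code N y < cube_code N r" if "r \<in> ?R" for r
            using that y_lt_R[of 0] yj by (auto simp: fun_upd_idem)
          ultimately show ?thesis using ymin[OF us] by (metis DiffI less_asym)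
        qed
      qed
      show "card ?R = card ?T" by (simp add: card_image injR injT)
      have "zeros S (x(k := c)) = zeros S (y(j := c))" for c
      proof -
        have "{i\<in>S - {k}. x i = 0} = {}" "{i\<in>S - {j}. y i = 0} = {}"
          using xpos gr_implies_not_zero[OF x_lt_y] by blast+
        then have "zeros (S - {k}) x = 0" "zeros (S - {j}) y = 0"
          by (simp_all only: zeros_def card.empty)
        then show ?thesis by (simp add: zeros_upd[OF finS] k jS)
      qed
      then show "weight S ?T \<le> weight S ?R"
        unfolding weight_def by (simp add: sum.reindex injR injT)
      show "code_sum N ?T < code_sum N ?R"
        unfolding code_sum_def sum.reindex[OF injR] sum.reindex[OF injT]
        by (rule sum_strict_mono) (auto intro: y_lt_R)
    qed simp
  qed
qed

section \<open>Initial segments minimise the weight\<close>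

theorem init_seg_minimises_weight:
  assumes "S \<subseteq> {1..N}" "finite A" "A \<subseteq> supported S" "down_set A"
    "init_seg N S I" "card I = card A"
  shows "weight S I \<le> weight S A"
  using assms
proof (induction "card S" arbitrary: S A I rule: less_induct)
  case less
  note S = less.prems(1)
  have finS: "finite S" using S finite_subset by blast
  note smaller = less.hyps
  show ?case
    using less.prems(2-)
  proof (induction "code_sum N A" arbitrary: A rule: less_induct)
    case (less A)
    note A = less.prems
    show ?case
    proof (cases "init_seg N S A")
      case True
      then have "I = A" using A S by (metis init_seg_subset order_refl subset_antisym)
      then show ?thesis by simp
    next
      case False
      have "\<exists>A'. finite A' \<and> A' \<subseteq> supported S \<and> down_set A' \<and> card A' = card A \<and>
        weight S A' \<le> weight S A \<and> code_sum N A' < code_sum N A"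
      proof (cases "\<exists>i\<in>S. \<exists>k. \<not> init_seg N (S - {i}) (section_at i A k)")
        case True
        then obtain i k where i: "i \<in> S" and k: "\<not> init_seg N (S - {i}) (section_at i A k)" by blast
        have "card (S - {i}) < card S" using i finS by (rule card_Diff1_less[rotated])
        from smaller[OF this] show ?thesis
          using compress_sections[OF S i A(1-3) k] S by blast
      next
        case all: False
        show ?thesis
        proof (rule exchange_when_compressed[OF S A(1-3) False])
          \<comment> \<open>Two points with a common \<open>i\<close>-th coordinate compare as their traces in the section do.\<close>
          fix u v i
          assume u: "u \<in> A" and v: "v \<in> supported S" and i: "i \<in> S" "u i = v i"
            and lt: "cube_code N v < cube_code N u"
          have iN: "i \<in> {1..N}" using i S by blast
          have "u(i := v i) = u" using i(2) by auto
          then have "cube_code N (v(i := 0)) < cube_code N (u(i := 0))"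
            using lt cube_code_upd[OF iN, of "v(i := 0)" "v i"] cube_code_upd[OF iN, of "u(i := 0)" "u i"] i
            by simp
          moreover have "v(i := 0) \<in> supported (S - {i})" using v by (auto simp: supported_def)
          moreover have "u(i := 0) \<in> section_at i A (u i)" using u by (simp add: section_at_def)
          ultimately have "v(i := 0) \<in> section_at i A (u i)"
            using all i unfolding init_seg_def by blast
          then show "v \<in> A" using i by (simp add: section_at_def)
        qed
      qed
      then obtain A' where A': "finite A'" "A' \<subseteq> supported S" "down_set A'" "card A' = card A"
        "weight S A' \<le> weight S A" "code_sum N A' < code_sum N A" by blast
      then have "weight S I \<le> weight S A'" using less.hyps(1) A by metis
      then show ?thesis using A' by simp
    qed
  qed
qed

section \<open>Shadow sums\<close>

lemma card_coord_proj_down_set: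
  assumes "down_set A"
  shows "card (coord_proj i ` A) = card {x\<in>A. x i = 0}"
proof -
  have "coord_proj i ` A = {x\<in>A. x i = 0}"
  proof (intro set_eqI iffI)
    fix z assume "z \<in> coord_proj i ` A"
    then obtain x where x: "x \<in> A" "z = x(i := 0)" by (auto simp: coord_proj_def)
    moreover have "x(i := 0) \<le> x" by (auto simp: le_fun_def)
    ultimately show "z \<in> {x\<in>A. x i = 0}" using assms by (auto simp: down_set_def)
  next
    fix z assume "z \<in> {x\<in>A. x i = 0}"
    then have "z = coord_proj i z" "z \<in> A" by (auto simp: coord_proj_def fun_upd_idem)
    then show "z \<in> coord_proj i ` A" by blast
  qed
  then show ?thesis by simp
qed

lemma init_seg_cube_init_seg:
  assumes "n \<ge> 1"
  shows "init_seg n {1..n} (cube_init_seg n m)" "card (cube_init_seg n m) = m"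
proof -
  note I = is_cube_init_seg_cube_init_seg[OF assms, of m, unfolded is_cube_init_seg_def]
  show "card (cube_init_seg n m) = m" using I by blast
  show "init_seg n {1..n} (cube_init_seg n m)"
    unfolding init_seg_def nat_points_eq_supported[symmetric]
    using I cube_less_iff_code_less by blast
qed

text \<open>Double counting of the pairs \<open>(x, i)\<close> with \<open>x i = 0\<close>.\<close>

lemma shadow_sum_eq_weight:
  assumes "n \<ge> 1"
  shows "shadow_sum n m = weight {1..n} (cube_init_seg n m)"
proof -
  let ?A = "cube_init_seg n m"
  have A: "down_set ?A" "finite ?A"
    using init_seg_down_set[OF _ init_seg_cube_init_seg(1)[OF assms]]
      init_seg_cube_init_seg(1)[OF assms, of m] by (auto simp: init_seg_def)
  have "shadow_sum n m = (\<Sum>i=1..n. \<Sum>x\<in>{x\<in>?A. x i = 0}. 1)"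
    unfolding shadow_sum_def card_coord_proj_down_set[OF A(1)] by simp
  also have "\<dots> = (\<Sum>x\<in>?A. \<Sum>i\<in>{i\<in>{1..n}. x i = 0}. 1)"
    using A(2) by (intro sum.swap_restrict) auto
  finally show ?thesis by (simp add: weight_def zeros_def)
qed

text \<open>
  Dimension one has to be treated apart, since in dimension zero no initial segment of length two or more
  exists that could serve as a layer.
\<close>

lemma shadow_sum_one_le: "shadow_sum 1 m \<le> min 1 m"
proof -
  note I = is_cube_init_seg_cube_init_seg[of 1 m, unfolded is_cube_init_seg_def]
  have "coord_proj 1 ` cube_init_seg 1 m \<subseteq> {\<lambda>_. 0}"
    using I by (auto simp: coord_proj_def nat_points_def fun_eq_iff)
  then have "card (coord_proj 1 ` cube_init_seg 1 m) \<le> card {\<lambda>_::nat. 0::nat}"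
    by (intro card_mono) auto
  moreover have "card (coord_proj 1 ` cube_init_seg 1 m) \<le> m"
    using I card_image_le by fastforce
  ultimately show ?thesis by (simp add: shadow_sum_def)
qed

text \<open>
  Piling up sets \<open>I 1, \<dots>, I s\<close> and letting every column fall down yields the layers \<open>{p. k < c p}\<close>, where
  \<open>c p\<close> is the height of the column over \<open>p\<close>. For nested sets these layers are the same sets in decreasing
  order, so describing them by column heights avoids sorting.
\<close>

lemma sum_over_layers:
  fixes I :: "nat \<Rightarrow> 'a set" and g :: "'a \<Rightarrow> nat"
  assumes "\<And>t. t \<in> {1..s} \<Longrightarrow> finite (I t)"
  defines "c \<equiv> \<lambda>p. card {t\<in>{1..s}. p \<in> I t}"
  shows "(\<Sum>k<s. \<Sum>p\<in>{p. k < c p}. g p) = (\<Sum>t=1..s. \<Sum>p\<in>I t. g p)"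
proof -
  define U where "U = (\<Union>t\<in>{1..s}. I t)"
  have fin: "finite U" using assms(1) by (auto simp: U_def)
  have c0: "p \<in> U" if "k < c p" for p k
  proof (rule ccontr)
    assume "p \<notin> U"
    then have "{t\<in>{1..s}. p \<in> I t} = {}" by (auto simp: U_def)
    then have "c p = 0" by (simp only: c_def card.empty)
    then show False using that by simp
  qed
  have cs: "c p \<le> s" for p
    using card_mono[of "{1..s}" "{t\<in>{1..s}. p \<in> I t}"] unfolding c_def by fastforce
  have "(\<Sum>k<s. \<Sum>p\<in>{p. k < c p}. g p) = (\<Sum>k<s. \<Sum>p\<in>{p\<in>U. k < c p}. g p)"
    using c0 by (intro sum.cong) auto
  also have "\<dots> = (\<Sum>p\<in>U. \<Sum>k\<in>{k\<in>{..<s}. k < c p}. g p)"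
    using fin by (intro sum.swap_restrict) auto
  also have "\<dots> = (\<Sum>p\<in>U. c p * g p)"
  proof (rule sum.cong)
    fix p
    have "{k\<in>{..<s}. k < c p} = {..<c p}" using cs[of p] by auto
    then show "(\<Sum>k\<in>{k\<in>{..<s}. k < c p}. g p) = c p * g p" by simp
  qed simp
  also have "\<dots> = (\<Sum>p\<in>U. \<Sum>t\<in>{t\<in>{1..s}. p \<in> I t}. g p)"
    by (simp add: c_def)
  also have "\<dots> = (\<Sum>t=1..s. \<Sum>p\<in>{p\<in>U. p \<in> I t}. g p)"
    using fin by (intro sum.swap_restrict) auto
  also have "\<dots> = (\<Sum>t=1..s. \<Sum>p\<in>I t. g p)"
    by (intro sum.cong) (auto simp: U_def)
  finally show ?thesis .
qed

theorem theorem3: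
  fixes n s :: nat and m :: "nat \<Rightarrow> nat"
  assumes "n \<ge> 1" and "s \<ge> 1"
  shows "shadow_sum n (\<Sum>k=1..s. m k)
           \<le> (\<Sum>k=1..s. shadow_sum (n - 1) (m k)) + Max (m ` {1..s})"
proof (cases "n = 1")
  case True
  have "min 1 (\<Sum>k=1..s. m k) \<le> Max (m ` {1..s})"
  proof (cases "\<forall>k\<in>{1..s}. m k = 0")
    case False
    then obtain k where "k \<in> {1..s}" "m k > 0" by blast
    moreover from this have "m k \<le> Max (m ` {1..s})" by simp
    ultimately show ?thesis by linarith
  qed simp
  then show ?thesis
    using shadow_sum_one_le[of "\<Sum>k=1..s. m k"] unfolding True by linarith
next
  case False
  then have n1: "n - 1 \<ge> 1" using assms(1) by simp
  have S: "{1..n} - {n} = {1..n - 1}" and n: "n \<in> {1..n}" using assms(1) by auto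
  define I where "I t = cube_init_seg (n - 1) (m t)" for t
  note I = init_seg_cube_init_seg[OF n1, of "m t" for t, folded I_def]
  have Ifin: "finite (I t)" and Isup: "I t \<subseteq> supported {1..n - 1}" for t
    using I(1)[of t] unfolding init_seg_def by auto
  have Idown: "down_set (I t)" for t
    using init_seg_down_set[OF _ I(1)] by simp
  define c where "c p = card {t\<in>{1..s}. p \<in> I t}" for p
  define B where "B k = {p. k < c p}" for k
  have BU: "B k \<subseteq> (\<Union>t\<in>{1..s}. I t)" for k
  proof
    fix p assume "p \<in> B k"
    then have "card {t\<in>{1..s}. p \<in> I t} \<noteq> 0"
      unfolding B_def c_def mem_Collect_eq by linarith
    then have "{t\<in>{1..s}. p \<in> I t} \<noteq> {}" by (metis card.empty)
    then show "p \<in> (\<Union>t\<in>{1..s}. I t)" by blast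
  qed
  have Bfin: "finite (B k)" for k
    by (rule finite_subset[OF BU]) (simp add: Ifin)
  have Bsup: "B k \<subseteq> supported ({1..n} - {n})" for k
    unfolding S using BU[of k] UN_least[of "{1..s}" I, OF Isup] by (rule order_trans)
  have B0: "p n = 0" if "p \<in> B k" for k p using Bsup that by (auto simp: supported_def)
  have cs: "c p \<le> s" for p
    using card_mono[of "{1..s}" "{t\<in>{1..s}. p \<in> I t}"] unfolding c_def by fastforce
  have BK: "B k = {}" if "k \<ge> s" for k
    using order_trans[OF cs that] by (auto simp: B_def not_less)
  have stB: "stackable n s B"
    using Bfin B0 BK by (auto simp: stackable_def)
  have Banti: "B l \<subseteq> B k" if "k \<le> l" for k l
    using that by (auto simp: B_def)
  have Bdown: "down_set (B k)" for k
    unfolding down_set_def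
  proof (intro ballI allI impI)
    fix x y assume x: "x \<in> B k" and le: "y \<le> x"
    have "c x \<le> c y" unfolding c_def
      using Idown le by (intro card_mono) (auto simp: down_set_def)
    then show "y \<in> B k" using x by (simp add: B_def)
  qed
  define A where "A = stack n B"
  have A: "finite A" "A \<subseteq> supported {1..n}" "down_set A"
    unfolding A_def
    by (rule finite_stack[OF stB], rule stack_supported[OF Bsup n], rule down_set_stack[OF Bdown Banti])
  have layers: "(\<Sum>k<s. \<Sum>p\<in>B k. g p) = (\<Sum>t=1..s. \<Sum>p\<in>I t. g p)" for g :: "_ \<Rightarrow> nat"
    unfolding B_def c_def by (rule sum_over_layers) (rule Ifin)
  have cardA: "card A = (\<Sum>t=1..s. m t)"
    unfolding A_def card_stack[OF stB] using layers[of "\<lambda>_. 1"] I(2) by simp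
  have "card (B 0) \<le> Max (m ` {1..s})"
  proof -
    have "Max (m ` {1..s}) \<in> m ` {1..s}" using assms(2) by (intro Max_in) auto
    then obtain t0 where t0: "t0 \<in> {1..s}" "m t0 = Max (m ` {1..s})" by auto
    have "I t \<subseteq> I t0" if "t \<in> {1..s}" for t
      using that t0(2) by (intro init_seg_subset[OF _ I(1) I(1)]) (simp_all add: I(2))
    then have "B 0 \<subseteq> I t0" using BU by blast
    then show ?thesis using card_mono[OF Ifin] I(2) t0(2) by metis
  qed
  moreover have "(\<Sum>k<s. weight {1..n - 1} (B k)) = (\<Sum>t=1..s. shadow_sum (n - 1) (m t))"
    unfolding shadow_sum_eq_weight[OF n1] weight_def layers I_def[symmetric] ..
  ultimately have "weight {1..n} A \<le> (\<Sum>t=1..s. shadow_sum (n - 1) (m t)) + Max (m ` {1..s})"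
    unfolding A_def weight_stack[OF finite_atLeastAtMost n stB] S by simp
  moreover have "shadow_sum n (\<Sum>k=1..s. m k) \<le> weight {1..n} A"
    unfolding shadow_sum_eq_weight[OF assms(1)]
    by (rule init_seg_minimises_weight[OF order_refl A])
      (simp_all only: init_seg_cube_init_seg[OF assms(1)] cardA)
  ultimately show ?thesis by simp
qed

end
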